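(* There exist absolute constants $K,c>0$ and $n_0$ such that for every $n\ge n_0$ there are a finite set $\mathcal{H}$ and a symmetric partial function $f:\mathrm{Dom}(f)\to\{0,1\}$, $\mathrm{Dom}(f)\subseteq\mathcal{H}^n$, for which $$QC(f)\le K\qquad\text{and}\qquad Q_2(f)\ge c\,\frac{n}{\log n}.$$ That is, there exists a symmetric partial $f$ with $QC(f)=O(1)$ and $Q_2(f)=\Omega(n/\log n)$.
   Context: Let $\mathcal{H}$ be a finite set and let $f:\mathrm{Dom}(f)\to\{0,1\}$ with $\mathrm{Dom}(f)\subseteq\mathcal{H}^n$ be a partial function. The input $Y=(y_1,\ldots,y_n)$ is accessed only through quantum queries, where a single query to index $i$ retrieves the whole value $y_i\in\mathcal{H}$ (standard unitary query oracle, applied in superposition over $i$); only queries are counted. $f$ is symmetric if for every permutation $\sigma$ of $\{1,\ldots,n\}$, $y_1\ldots y_n\in\mathrm{Dom}(f)$ implies $y_{\sigma(1)}\ldots y_{\sigma(n)}\in\mathrm{Dom}(f)$ and $f(y_1\ldots y_n)=f(y_{\sigma(1)}\ldots y_{\sigma(n)})$. $Q_2(f)$ is the minimum number of queries made by a quantum algorithm that, for every $Y\in\mathrm{Dom}(f)$, outputs $f(Y)$ with probability at least $2/3$. A quantum verifier for $X\in\mathrm{Dom}(f)$ is a quantum query algorithm that, on input $Y\in\mathrm{Dom}(f)$, (i) accepts with probability $1$ if $Y=X$, and (ii) rejects with probability at least $1/2$ if $f(Y)\ne f(X)$ (otherwise the acceptance probability can be arbitrary). The algorithm may depend on $X$ and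 $f$. $QC^X(f)$ is the minimum number of queries used by a quantum verifier for $X$, and $QC(f)=\max_{X\in\mathrm{Dom}(f)}QC^X(f)$. *)

theory Defs
  imports
    "Jordan_Normal_Form.Schur_Decomposition"
    "HOL-Combinatorics.Permutations"
    "HOL-Library.Countable_Set"
    "HOL-Library.Extended_Real"
begin

text \<open>
  An input of length \<open>n\<close> over the alphabet \<open>H\<close> is a list \<open>Y\<close> with positions \<open>0, \<dots>, n - 1\<close>. A partial
  function to \<open>{0,1}\<close> is a map \<open>f\<close> into \<open>bool option\<close>, with domain \<open>dom f\<close>.
\<close>

definition inputs :: "'h set \<Rightarrow> nat \<Rightarrow> 'h list set" where
  "inputs H n = {Y. set Y \<subseteq> H \<and> length Y = n}"

definition symmetric_pfun :: "nat \<Rightarrow> ('h list \<rightharpoonup> bool) \<Rightarrow> bool" where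
  "symmetric_pfun n f \<longleftrightarrow>
     (\<forall>\<sigma>. \<sigma> permutes {..<n} \<longrightarrow>
        (\<forall>Y\<in>dom f. permute_list \<sigma> Y \<in> dom f \<and> f (permute_list \<sigma> Y) = f Y))"

text \<open>
  The state space has the orthonormal basis \<open>|i, a, z\<rangle>\<close> with query index \<open>i < n\<close>, answer register
  \<open>a < card H\<close> and workspace \<open>z < w\<close>; this basis vector has number \<open>(i * card H + a) * w + z\<close>.
  The function \<open>basis_label\<close> recovers the triple from the number.
\<close>

definition state_dim :: "'h set \<Rightarrow> nat \<Rightarrow> nat \<Rightarrow> nat" where
  "state_dim H n w = n * card H * w"

definition basis_label :: "'h set \<Rightarrow> nat \<Rightarrow> nat \<Rightarrow> nat \<times> nat \<times> nat" where
  "basis_label H w r = (r div w div card H, r div w mod card H, r mod w)"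

text \<open>
  A query acts as \<open>|i, a, z\<rangle> \<mapsto> |i, a + y\<^sub>i, z\<rangle>\<close>, where the letters of the finite alphabet \<open>H\<close>
  are identified with the residues modulo \<open>card H\<close> by the bijection \<open>to_nat_on H\<close>. The choice of the
  bijection matters only up to a constant factor in the number of queries: two queries read a whole
  letter into a fresh workspace register and restore the answer register, whatever the bijection.
\<close>

definition query_op :: "'h set \<Rightarrow> nat \<Rightarrow> nat \<Rightarrow> 'h list \<Rightarrow> complex mat" where
  "query_op H n w Y = mat (state_dim H n w) (state_dim H n w) (\<lambda>(r, s).
     case basis_label H w s of (i, a, z) \<Rightarrow>
       if basis_label H w r = (i, (a + to_nat_on H (Y ! i)) mod card H, z) then 1 else 0)"

definition unitary_mat :: "nat \<Rightarrow> complex mat \<Rightarrow> bool" where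
  "unitary_mat d U \<longleftrightarrow> U \<in> carrier_mat d d \<and> mat_adjoint U * U = 1\<^sub>m d \<and> U * mat_adjoint U = 1\<^sub>m d"

text \<open>
  An algorithm with \<open>T\<close> queries applies \<open>gate T * O * gate (T - 1) * \<dots> * O * gate 0\<close> to
  \<open>|0, 0, 0\<rangle>\<close>, where \<open>O\<close> is the query operator, and measures in the computational basis. It outputs \<open>1\<close>
  (accepts) iff the measured basis vector is in \<open>accepting\<close>. The gates do not depend on the input.
\<close>

record query_alg =
  work_dim :: nat
  num_queries :: nat
  gate :: "nat \<Rightarrow> complex mat"
  accepting :: "nat set"

definition query_alg_on :: "'h set \<Rightarrow> nat \<Rightarrow> query_alg \<Rightarrow> bool" where
  "query_alg_on H n A \<longleftrightarrow>
     work_dim A > 0 \<and> (\<forall>t\<le>num_queries A. unitary_mat (state_dim H n (work_dim A)) (gate A t))"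

primrec state_after :: "'h set \<Rightarrow> nat \<Rightarrow> query_alg \<Rightarrow> 'h list \<Rightarrow> nat \<Rightarrow> complex vec" where
  "state_after H n A Y 0 = gate A 0 *\<^sub>v unit_vec (state_dim H n (work_dim A)) 0"
| "state_after H n A Y (Suc t) =
     gate A (Suc t) *\<^sub>v (query_op H n (work_dim A) Y *\<^sub>v state_after H n A Y t)"

definition output_prob :: "'h set \<Rightarrow> nat \<Rightarrow> query_alg \<Rightarrow> 'h list \<Rightarrow> bool \<Rightarrow> real" where
  "output_prob H n A Y b =
     (\<Sum>r | r < state_dim H n (work_dim A) \<and> (r \<in> accepting A \<longleftrightarrow> b).
        (cmod (state_after H n A Y (num_queries A) $ r))\<^sup>2)"

definition computes_bounded_error ::
    "'h set \<Rightarrow> nat \<Rightarrow> ('h list \<rightharpoonup> bool) \<Rightarrow> query_alg \<Rightarrow> bool" where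
  "computes_bounded_error H n f A \<longleftrightarrow>
     query_alg_on H n A \<and> (\<forall>Y\<in>dom f. output_prob H n A Y (the (f Y)) \<ge> 2/3)"

definition quantum_verifier ::
    "'h set \<Rightarrow> nat \<Rightarrow> ('h list \<rightharpoonup> bool) \<Rightarrow> 'h list \<Rightarrow> query_alg \<Rightarrow> bool" where
  "quantum_verifier H n f X A \<longleftrightarrow>
     query_alg_on H n A \<and>
     output_prob H n A X True = 1 \<and>
     (\<forall>Y\<in>dom f. f Y \<noteq> f X \<longrightarrow> output_prob H n A Y False \<ge> 1/2)"

text \<open>
  Minimum numbers of queries are infima in \<open>enat\<close>, which are attained whenever some algorithm
  exists; for \<open>n > 0\<close> and \<open>dom f \<subseteq> inputs H n\<close> this is always so, since \<open>n\<close> queries read the whole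
  input. In \<open>enat\<close>, unlike in \<open>nat\<close>, the infimum of the empty set is not \<open>0\<close>, and the supremum over
  the finite set \<open>dom f\<close> is the maximum.
\<close>

definition Q2 :: "'h set \<Rightarrow> nat \<Rightarrow> ('h list \<rightharpoonup> bool) \<Rightarrow> enat" where
  "Q2 H n f = (INF A\<in>{A. computes_bounded_error H n f A}. enat (num_queries A))"

definition QC_at :: "'h set \<Rightarrow> nat \<Rightarrow> ('h list \<rightharpoonup> bool) \<Rightarrow> 'h list \<Rightarrow> enat" where
  "QC_at H n f X = (INF A\<in>{A. quantum_verifier H n f X A}. enat (num_queries A))"

definition QC :: "'h set \<Rightarrow> nat \<Rightarrow> ('h list \<rightharpoonup> bool) \<Rightarrow> enat" where
  "QC H n f = (SUP X\<in>dom f. QC_at H n f X)"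

end

theory Submission
  imports Defs "HOL-Library.Nat_Bijection" "HOL-Number_Theory.Cong"
begin

text \<open>
  The letter at position \<open>i\<close> of a code word carries its own position, so permuting a word loses nothing,
  and a symmetric \<open>f\<close> can assign an arbitrary bit to each word of a code. If distinct words agree in at
  most half of the positions, then querying a uniformly random position and accepting iff the letter
  occurs in \<open>X\<close> is a verifier for \<open>X\<close>. For the lower bound, the acceptance probability of an algorithm
  with \<open>T\<close> queries is a combination of at most \<open>(n * card H + 1) ^ (2 * T)\<close> monomials that do not depend
  on the algorithm. If the code has more words than that, some nonzero real vector \<open>l\<close> on the code is
  orthogonal to all of these monomials, and labelling each word by the sign of \<open>l\<close> gives a function that
  \<open>T\<close> queries cannot compute. Evaluating integer polynomials of degree at most \<open>n div 2\<close> with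
  coefficients below \<open>n ^ (n div 2 + 1)\<close> at \<open>0, \<dots>, n - 1\<close> gives a code with so many words that \<open>T\<close> may
  be linear in \<open>n\<close>.
\<close>

section \<open>Linear relations\<close>

text \<open>Gaussian elimination, by induction on the equations. A pivot \<open>e\<close> with
  \<open>m j e \<noteq> 0\<close> is used to remove the unknown \<open>e\<close> from the other
  equations. These are solved by induction, and the value at \<open>e\<close> is then read off from
  equation \<open>j\<close>.\<close>

lemma nontrivial_relation:
  fixes m :: "'j \<Rightarrow> 'd \<Rightarrow> 'a::field"
  assumes "finite J" "finite D" "card J < card D"
  shows "\<exists>l. (\<exists>d\<in>D. l d \<noteq> 0) \<and> (\<forall>j\<in>J. (\<Sum>d\<in>D. l d * m j d) = 0)"
  using assms
proof (induction J arbitrary: D m rule: finite_induct)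
  case empty
  then obtain d where "d \<in> D"
    by fastforce
  then show ?case
    by (intro exI[of _ "\<lambda>_. 1"]) auto
next
  case (insert j J)
  show ?case
  proof (cases "\<forall>d\<in>D. m j d = 0")
    case True
    obtain l where "\<exists>d\<in>D. l d \<noteq> 0" "\<forall>i\<in>J. (\<Sum>d\<in>D. l d * m i d) = 0"
      using insert.IH[of D m] insert.prems insert.hyps by auto
    with True show ?thesis
      by (intro exI[of _ l]) auto
  next
    case False
    then obtain e where e: "e \<in> D" "m j e \<noteq> 0"
      by blast
    define m' where "m' i d = m i d - m i e * m j d / m j e" for i d
    have "card J < card (D - {e})"
      using insert.prems insert.hyps e by (simp add: card_Diff_singleton)
    then obtain l where l: "\<exists>d\<in>D - {e}. l d \<noteq> 0" "\<forall>i\<in>J. (\<Sum>d\<in>D - {e}. l d * m' i d) = 0"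
      using insert.IH[of "D - {e}" m'] insert.prems by auto
    define l' where "l' = l(e := - (\<Sum>d\<in>D - {e}. l d * m j d) / m j e)"
    have sum_l': "(\<Sum>d\<in>D. l' d * m i d) = (\<Sum>d\<in>D - {e}. l d * m' i d)" for i
    proof -
      have "(\<Sum>d\<in>D. l' d * m i d) = l' e * m i e + (\<Sum>d\<in>D - {e}. l' d * m i d)"
        using insert.prems e by (simp add: sum.remove)
      also have "(\<Sum>d\<in>D - {e}. l' d * m i d) = (\<Sum>d\<in>D - {e}. l d * m i d)"
        by (intro sum.cong) (auto simp: l'_def)
      also have "l' e * m i e = - (\<Sum>d\<in>D - {e}. l d * (m i e * m j d / m j e))"
        by (simp add: l'_def sum_distrib_left sum_divide_distrib sum_distrib_right algebra_simps)
      also have "\<dots> + (\<Sum>d\<in>D - {e}. l d * m i d) = (\<Sum>d\<in>D - {e}. l d * m' i d)"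
        by (simp add: m'_def right_diff_distrib sum_subtractf)
      finally show ?thesis .
    qed
    \<comment> \<open>Elimination turns row \<open>j\<close> itself into the zero row, so
      \<open>sum_l'\<close> settles equation \<open>j\<close> together with those in
      \<open>J\<close>.\<close>
    have "m' j d = 0" for d
      using e by (simp add: m'_def)
    then have "\<forall>i\<in>insert j J. (\<Sum>d\<in>D. l' d * m i d) = 0"
      using l(2) by (auto simp: sum_l')
    moreover have "\<exists>d\<in>D. l' d \<noteq> 0"
      using l(1) by (auto simp: l'_def)
    ultimately show ?thesis
      by blast
  qed
qed

section \<open>Queries and norms\<close>

text \<open>The permutation of basis numbers whose permutation matrix is
  \<open>query_op\<close>.\<close>

definition query_target :: "'h set \<Rightarrow> nat \<Rightarrow> 'h list \<Rightarrow> nat \<Rightarrow> nat" where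
  "query_target H w Y s = (case basis_label H w s of (i, a, z) \<Rightarrow>
     (i * card H + (a + to_nat_on H (Y ! i)) mod card H) * w + z)"

lemma basis_label_number:
  assumes "a < card H" "z < w"
  shows "basis_label H w ((i * card H + a) * w + z) = (i, a, z)"
  using assms by (simp add: basis_label_def)

lemma number_less_state_dim:
  assumes "i < n" "a < card H" "z < w"
  shows "(i * card H + a) * w + z < state_dim H n w"
proof -
  have step: "k * m + l < p * m" if "k < p" "l < m" for k l m p :: nat
  proof -
    have "k * m + l < Suc k * m"
      using that by simp
    also have "\<dots> \<le> p * m"
      using that by (intro mult_le_mono1) simp
    finally show ?thesis .
  qed
  show ?thesis
    unfolding state_dim_def using assms by (intro step)
qed

lemma basis_labelE:
  assumes "s < state_dim H n w"
  obtains i a z where "i < n" "a < card H" "z < w" "s = (i * card H + a) * w + z"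
    "basis_label H w s = (i, a, z)"
proof
  show "s div w div card H < n"
    using assms by (simp add: state_dim_def less_mult_imp_div_less mult.commute mult.assoc)
  have "0 < card H" "0 < w"
    using assms by (auto simp: state_dim_def intro!: Nat.gr0I)
  then show "s div w mod card H < card H" "s mod w < w"
    by auto
  show "s = (s div w div card H * card H + s div w mod card H) * w + s mod w"
    by simp
qed (simp add: basis_label_def)

text \<open>A query keeps \<open>i\<close> and \<open>z\<close>, so two colliding basis vectors are
  shifted by the same letter, and the shift cancels modulo \<open>card H\<close>. An injective
  self-map of a finite set is onto.\<close>

lemma bij_betw_query_target: "bij_betw (query_target H w Y) {..<state_dim H n w} {..<state_dim H n w}"
proof -
  have "inj_on (query_target H w Y) {..<state_dim H n w}"
  proof (rule inj_onI)
    fix s s'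
    assume "s \<in> {..<state_dim H n w}" "s' \<in> {..<state_dim H n w}"
      and eq: "query_target H w Y s = query_target H w Y s'"
    then have "s < state_dim H n w" "s' < state_dim H n w"
      by auto
    from this(1) obtain i a z where s: "a < card H" "z < w" "s = (i * card H + a) * w + z"
      "basis_label H w s = (i, a, z)"
      by (rule basis_labelE)
    from \<open>s' < _\<close> obtain i' a' z' where s': "a' < card H" "z' < w" "s' = (i' * card H + a') * w + z'"
      "basis_label H w s' = (i', a', z')"
      by (rule basis_labelE)
    have "basis_label H w (query_target H w Y s) = (i, (a + to_nat_on H (Y ! i)) mod card H, z)"
      using s by (auto simp: query_target_def intro!: basis_label_number)
    moreover have "basis_label H w (query_target H w Y s') =
        (i', (a' + to_nat_on H (Y ! i')) mod card H, z')"
      using s' by (auto simp: query_target_def intro!: basis_label_number)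
    ultimately have "i = i'" "z = z'"
      "(a + to_nat_on H (Y ! i)) mod card H = (a' + to_nat_on H (Y ! i)) mod card H"
      using eq by auto
    moreover from this(3) have "a = a'"
      using s(1) s'(1) cong_add_rcancel_nat[of a "to_nat_on H (Y ! i)" a' "card H"]
      by (simp add: cong_def)
    ultimately show "s = s'"
      using s s' by simp
  qed
  moreover have "query_target H w Y ` {..<state_dim H n w} \<subseteq> {..<state_dim H n w}"
  proof (rule image_subsetI)
    fix s assume "s \<in> {..<state_dim H n w}"
    then have "s < state_dim H n w"
      by simp
    then obtain i a z where "i < n" "a < card H" "z < w" "basis_label H w s = (i, a, z)"
      by (rule basis_labelE)
    then show "query_target H w Y s \<in> {..<state_dim H n w}"
      by (auto simp: query_target_def intro!: number_less_state_dim)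
  qed
  ultimately show ?thesis
    by (simp add: bij_betw_def endo_inj_surj)
qed

section \<open>The query operator as a permutation matrix\<close>

lemma query_op_carrier [simp]: "query_op H n w Y \<in> carrier_mat (state_dim H n w) (state_dim H n w)"
  by (simp add: query_op_def)

lemma query_op_entry:
  assumes "r < state_dim H n w" "s < state_dim H n w"
  shows "query_op H n w Y $$ (r, s) = (if r = query_target H w Y s then 1 else 0)"
proof -
  from assms(2) obtain i a z where s: "a < card H" "z < w" "basis_label H w s = (i, a, z)"
    by (rule basis_labelE)
  from assms(1) obtain i' a' z' where r: "a' < card H" "z' < w" "r = (i' * card H + a') * w + z'"
      "basis_label H w r = (i', a', z')"
    by (rule basis_labelE)
  have "basis_label H w (query_target H w Y s) = (i, (a + to_nat_on H (Y ! i)) mod card H, z)"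
    using s by (auto simp: query_target_def intro!: basis_label_number)
  then have "basis_label H w r = (i, (a + to_nat_on H (Y ! i)) mod card H, z) \<longleftrightarrow>
      r = query_target H w Y s"
    using r s by (auto simp: query_target_def)
  then show ?thesis
    using assms s by (simp add: query_op_def)
qed

lemma mult_mat_vec_index_sum:
  assumes "A \<in> carrier_mat d d" "v \<in> carrier_vec d" "r < d"
  shows "(A *\<^sub>v v) $ r = (\<Sum>s<d. A $$ (r, s) * v $ s)"
  using assms by (auto simp: scalar_prod_def atLeast0LessThan intro!: sum.cong)

text \<open>Reading the result at the target index avoids the inverse permutation. By injectivity
  only column \<open>s\<close> contributes to that row.\<close>

lemma query_op_mult_vec:
  assumes "v \<in> carrier_vec (state_dim H n w)" "s < state_dim H n w"
  shows "(query_op H n w Y *\<^sub>v v) $ (query_target H w Y s) = v $ s"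
proof -
  let ?d = "state_dim H n w"
  have bij: "bij_betw (query_target H w Y) {..<?d} {..<?d}"
    by (rule bij_betw_query_target)
  then have "query_target H w Y s < ?d"
    using assms(2) by (auto simp: bij_betw_def)
  then have "(query_op H n w Y *\<^sub>v v) $ (query_target H w Y s) =
      (\<Sum>u<?d. query_op H n w Y $$ (query_target H w Y s, u) * v $ u)"
    using assms by (intro mult_mat_vec_index_sum) auto
  also have "\<dots> = (\<Sum>u<?d. if u = s then v $ u else 0)"
  proof (intro sum.cong refl)
    fix u assume "u \<in> {..<?d}"
    then show "query_op H n w Y $$ (query_target H w Y s, u) * v $ u = (if u = s then v $ u else 0)"
      using \<open>query_target H w Y s < ?d\<close> assms(2) bij
      by (auto simp: query_op_entry bij_betw_def inj_on_def)
  qed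
  finally show ?thesis
    using assms(2) by simp
qed

section \<open>Norm preservation and total probability\<close>

definition sqnorm :: "complex vec \<Rightarrow> real" where
  "sqnorm v = (\<Sum>r<dim_vec v. (cmod (v $ r))\<^sup>2)"

lemma sqnorm_query_op:
  assumes "v \<in> carrier_vec (state_dim H n w)"
  shows "sqnorm (query_op H n w Y *\<^sub>v v) = sqnorm v"
proof -
  let ?d = "state_dim H n w"
  have "sqnorm (query_op H n w Y *\<^sub>v v) = (\<Sum>r<?d. (cmod ((query_op H n w Y *\<^sub>v v) $ r))\<^sup>2)"
    by (simp add: sqnorm_def query_op_def)
  also have "\<dots> = (\<Sum>s<?d. (cmod ((query_op H n w Y *\<^sub>v v) $ query_target H w Y s))\<^sup>2)"
    by (rule sum.reindex_bij_betw[OF bij_betw_query_target, symmetric])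
  also have "\<dots> = sqnorm v"
    using assms by (simp add: sqnorm_def query_op_mult_vec)
  finally show ?thesis .
qed

lemma mat_adjoint_carrier: "U \<in> carrier_mat d d \<Longrightarrow> mat_adjoint U \<in> carrier_mat d d"
  by (simp add: mat_adjoint_def mat_of_rows_def)

lemma mat_adjoint_entry:
  assumes "U \<in> carrier_mat d d" "r < d" "s < d"
  shows "mat_adjoint U $$ (r, s) = cnj (U $$ (s, r))"
  using assms by (simp add: mat_adjoint_def mat_of_rows_def conjugate_vec_def)

lemma sqnorm_unitary_mat:
  assumes "unitary_mat d U" "v \<in> carrier_vec d"
  shows "sqnorm (U *\<^sub>v v) = sqnorm v"
proof -
  have U: "U \<in> carrier_mat d d" and UU: "mat_adjoint U * U = 1\<^sub>m d"
    using assms(1) by (auto simp: unitary_mat_def)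
  \<comment> \<open>The columns of \<open>U\<close> are orthonormal.\<close>
  have orth: "(\<Sum>r<d. cnj (U $$ (r, s)) * U $$ (r, t)) = (if s = t then 1 else 0)"
    if "s < d" "t < d" for s t
  proof -
    have "(mat_adjoint U * U) $$ (s, t) = (\<Sum>r<d. mat_adjoint U $$ (s, r) * U $$ (r, t))"
      using that U mat_adjoint_carrier[OF U]
      by (auto simp: scalar_prod_def atLeast0LessThan intro!: sum.cong)
    then show ?thesis
      using that U by (simp add: UU mat_adjoint_entry)
  qed
  have "complex_of_real (sqnorm (U *\<^sub>v v)) = (\<Sum>r<d. cnj ((U *\<^sub>v v) $ r) * (U *\<^sub>v v) $ r)"
    using U by (simp add: sqnorm_def complex_norm_square mult.commute
        del: of_real_power index_mult_mat_vec)
  also have "\<dots> = (\<Sum>r<d. \<Sum>s<d. \<Sum>t<d. cnj (v $ s) * v $ t * (cnj (U $$ (r, s)) * U $$ (r, t)))"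
  proof (intro sum.cong refl)
    fix r assume "r \<in> {..<d}"
    then have "(U *\<^sub>v v) $ r = (\<Sum>s<d. U $$ (r, s) * v $ s)"
      using mult_mat_vec_index_sum[OF U assms(2)] by simp
    then have entry: "cnj ((U *\<^sub>v v) $ r) * (U *\<^sub>v v) $ r =
        (\<Sum>s<d. cnj (U $$ (r, s)) * cnj (v $ s)) * (\<Sum>t<d. U $$ (r, t) * v $ t)"
      by (simp del: index_mult_mat_vec)
    show "cnj ((U *\<^sub>v v) $ r) * (U *\<^sub>v v) $ r =
        (\<Sum>s<d. \<Sum>t<d. cnj (v $ s) * v $ t * (cnj (U $$ (r, s)) * U $$ (r, t)))"
      unfolding entry sum_product by (simp add: mult_ac)
  qed
  \<comment> \<open>Moving the sum over \<open>r\<close> inside exposes the inner products of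
    columns.\<close>
  also have "\<dots> = (\<Sum>s<d. \<Sum>t<d. cnj (v $ s) * v $ t * (\<Sum>r<d. cnj (U $$ (r, s)) * U $$ (r, t)))"
    by (subst sum.swap, rule sum.cong[OF refl], subst sum.swap) (simp add: sum_distrib_left)
  also have "\<dots> = (\<Sum>s<d. \<Sum>t<d. if s = t then cnj (v $ s) * v $ t else 0)"
    by (intro sum.cong refl) (simp add: orth)
  also have "\<dots> = (\<Sum>s<d. cnj (v $ s) * v $ s)"
    by (intro sum.cong refl) simp
  also have "\<dots> = complex_of_real (sqnorm v)"
    using assms(2) by (simp add: sqnorm_def complex_norm_square mult.commute del: of_real_power)
  finally show ?thesis
    by (simp only: of_real_eq_iff)
qed

lemma state_after_carrier:
  assumes "query_alg_on H n A" "t \<le> num_queries A"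
  shows "state_after H n A Y t \<in> carrier_vec (state_dim H n (work_dim A))"
proof -
  have gate: "gate A t \<in> carrier_mat (state_dim H n (work_dim A)) (state_dim H n (work_dim A))"
    using assms by (simp add: query_alg_on_def unitary_mat_def)
  then have "dim_vec (state_after H n A Y t) = state_dim H n (work_dim A)"
    by (cases t) auto
  then show ?thesis
    by (rule carrier_vecI)
qed

text \<open>In dimension 0 the starting vector is empty and has norm 0, hence the positivity
  assumption.\<close>

lemma sqnorm_state_after:
  assumes "query_alg_on H n A" "0 < state_dim H n (work_dim A)" "t \<le> num_queries A"
  shows "sqnorm (state_after H n A Y t) = 1"
  using assms(3)
proof (induction t)
  case 0
  have "sqnorm (unit_vec (state_dim H n (work_dim A)) 0) = 1"
  proof -
    have "sqnorm (unit_vec (state_dim H n (work_dim A)) 0) =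
        (\<Sum>r<state_dim H n (work_dim A). if r = 0 then 1 else 0)"
      unfolding sqnorm_def by (intro sum.cong) auto
    then show ?thesis
      using assms(2) by simp
  qed
  moreover have "unitary_mat (state_dim H n (work_dim A)) (gate A 0)"
    using assms(1) by (auto simp: query_alg_on_def)
  ultimately show ?case
    by (simp add: sqnorm_unitary_mat)
next
  case (Suc t)
  have "unitary_mat (state_dim H n (work_dim A)) (gate A (Suc t))"
    using assms(1) Suc.prems by (auto simp: query_alg_on_def)
  moreover have "state_after H n A Y t \<in> carrier_vec (state_dim H n (work_dim A))"
    using assms(1) Suc.prems by (simp add: state_after_carrier)
  ultimately show ?case
    using Suc by (simp add: sqnorm_unitary_mat sqnorm_query_op mult_mat_vec_carrier[OF query_op_carrier])
qed

lemma output_prob_True_plus_False: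
  assumes "query_alg_on H n A" "0 < state_dim H n (work_dim A)"
  shows "output_prob H n A Y True + output_prob H n A Y False = 1"
proof -
  let ?d = "state_dim H n (work_dim A)"
  let ?p = "\<lambda>r. (cmod (state_after H n A Y (num_queries A) $ r))\<^sup>2"
  have "output_prob H n A Y True + output_prob H n A Y False =
      sum ?p {r. r < ?d \<and> r \<in> accepting A} + sum ?p {r. r < ?d \<and> r \<notin> accepting A}"
    by (simp add: output_prob_def)
  also have "\<dots> = sum ?p {..<?d}"
    by (subst sum.union_disjoint[symmetric]) (auto intro!: sum.cong)
  also have "\<dots> = 1"
    using sqnorm_state_after[OF assms order_refl, of Y] state_after_carrier[OF assms(1) order_refl, of Y]
    by (simp add: sqnorm_def)
  finally show ?thesis .
qed

section \<open>Few queries span few functions\<close>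

text \<open>The index \<open>t\<close> is an upper bound: functions of fewer than \<open>t\<close> letters are included.\<close>

inductive query_span :: "'h list set \<Rightarrow> (nat \<times> 'h) set \<Rightarrow> nat \<Rightarrow> ('h list \<Rightarrow> complex) \<Rightarrow> bool"
  for D P where
  const: "query_span D P t (\<lambda>_. c)"
| query: "query_span D P t F \<Longrightarrow> (i, h) \<in> P \<Longrightarrow> query_span D P (Suc t) (\<lambda>Y. of_bool (Y ! i = h) * F Y)"
| add: "query_span D P t F \<Longrightarrow> query_span D P t G \<Longrightarrow> query_span D P t (\<lambda>Y. F Y + G Y)"
| cong: "query_span D P t F \<Longrightarrow> (\<And>Y. Y \<in> D \<Longrightarrow> F Y = G Y) \<Longrightarrow> query_span D P t G"

lemma query_span_sum:
  assumes "\<And>i. i \<in> I \<Longrightarrow> query_span D P t (F i)"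
  shows "query_span D P t (\<lambda>Y. \<Sum>i\<in>I. F i Y)"
  using assms
proof (induction I rule: infinite_finite_induct)
  case (insert i I)
  then show ?case
    using query_span.add[of D P t "F i" "\<lambda>Y. \<Sum>i\<in>I. F i Y"] by simp
qed (simp_all add: query_span.const)

lemma query_span_increase:
  assumes "query_span D P t F"
  shows "query_span D P (s + t) F"
  using assms
proof (induction rule: query_span.induct)
  case (const t c)
  show ?case
    by (rule query_span.const)
next
  case (query t F i h)
  then show ?case
    using query_span.query[of D P "s + t" F i h] by simp
next
  case (add t F G)
  show ?case
    by (rule query_span.add[OF add.IH])
next
  case (cong t F G)
  show ?case
    using cong.IH cong.hyps(2) by (rule query_span.cong)
qed

lemma query_span_cmult:
  assumes "query_span D P t F"
  shows "query_span D P t (\<lambda>Y. c * F Y)"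
  using assms
proof (induction rule: query_span.induct)
  case (const t k)
  show ?case
    by (rule query_span.const)
next
  case (query t F i h)
  show ?case
    using query_span.query[OF query.IH query.hyps(2)] by (rule query_span.cong) simp
next
  case (add t F G)
  show ?case
    using query_span.add[OF add.IH] by (rule query_span.cong) (simp add: distrib_left)
next
  case (cong t F G)
  show ?case
    using cong.IH by (rule query_span.cong) (simp add: cong.hyps)
qed

text \<open>Induction on the first factor alone. It serves for amplitude times conjugate amplitude,
  where the degree doubles.\<close>

lemma query_span_mult:
  assumes "query_span D P s F" "query_span D P t G"
  shows "query_span D P (s + t) (\<lambda>Y. F Y * G Y)"
  using assms(1)
proof (induction rule: query_span.induct)
  case (const s c)
  show ?case
    by (rule query_span_cmult[OF query_span_increase[OF assms(2)]])
next
  case (query s F i h)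
  show ?case
    using query_span.query[OF query.IH query.hyps(2)] by (simp add: mult.assoc)
next
  case (add s F F')
  show ?case
    using query_span.add[OF add.IH] by (rule query_span.cong) (simp add: distrib_right)
next
  case (cong s F F')
  show ?case
    using cong.IH by (rule query_span.cong) (simp add: cong.hyps)
qed

lemma query_span_cnj:
  assumes "query_span D P t F"
  shows "query_span D P t (\<lambda>Y. cnj (F Y))"
  using assms
proof (induction rule: query_span.induct)
  case (const t k)
  show ?case
    by (rule query_span.const)
next
  case (query t F i h)
  show ?case
    using query_span.query[OF query.IH query.hyps(2)] by (rule query_span.cong) simp
next
  case (add t F G)
  show ?case
    using query_span.add[OF add.IH] by (rule query_span.cong) simp
next
  case (cong t F G)
  show ?case
    using cong.IH by (rule query_span.cong) (simp add: cong.hyps)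
qed

text \<open>A product of letter indicators. The list may repeat pairs or demand two letters at one
  position; this only overcounts, and lists of bounded length are easy to count.\<close>

definition monomial :: "(nat \<times> 'h) list \<Rightarrow> 'h list \<Rightarrow> bool" where
  "monomial \<alpha> Y \<longleftrightarrow> (\<forall>(i, h)\<in>set \<alpha>. Y ! i = h)"

text \<open>The extra factor \<open>monomial \<alpha>\<close> makes the induction work: each
  indicator met in \<open>F\<close> moves into \<open>\<alpha>\<close>, which grows by one while
  \<open>t\<close> drops by one. The case of interest is the empty \<open>\<alpha>\<close>.\<close>

lemma query_span_orthogonal:
  assumes "query_span D P t F" "E \<subseteq> D"
    and "\<And>\<alpha>. set \<alpha> \<subseteq> P \<Longrightarrow> length \<alpha> \<le> k \<Longrightarrow> (\<Sum>Y\<in>E. l Y * of_bool (monomial \<alpha> Y)) = 0"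
    and "set \<alpha> \<subseteq> P" "length \<alpha> + t \<le> k"
  shows "(\<Sum>Y\<in>E. l Y * (of_bool (monomial \<alpha> Y) * F Y)) = 0"
  using assms(1,4,5)
proof (induction arbitrary: \<alpha> rule: query_span.induct)
  case (const t c)
  then have "(\<Sum>Y\<in>E. l Y * of_bool (monomial \<alpha> Y)) * c = 0"
    by (simp add: assms(3))
  then show ?case
    unfolding sum_distrib_right by (simp only: mult.assoc)
next
  case (query t F i h)
  have "(\<Sum>Y\<in>E. l Y * (of_bool (monomial \<alpha> Y) * (of_bool (Y ! i = h) * F Y))) =
      (\<Sum>Y\<in>E. l Y * (of_bool (monomial ((i, h) # \<alpha>) Y) * F Y))"
    by (intro sum.cong) (auto simp: monomial_def)
  also have "\<dots> = 0"
    using query.prems query.hyps(2) by (intro query.IH) auto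
  finally show ?case .
next
  case (add t F G)
  then show ?case
    by (simp add: distrib_left sum.distrib)
next
  case (cong t F G)
  have "(\<Sum>Y\<in>E. l Y * (of_bool (monomial \<alpha> Y) * G Y)) = (\<Sum>Y\<in>E. l Y * (of_bool (monomial \<alpha> Y) * F Y))"
    using cong.hyps(2) assms(2) by (intro sum.cong) auto
  also have "\<dots> = 0"
    using cong.prems by (rule cong.IH)
  finally show ?case .
qed

section \<open>Amplitudes and probabilities as polynomials in letter indicators\<close>

text \<open>Column \<open>q\<close> fixes the queried position \<open>i\<close>, so the entry
  depends on the input only through \<open>Y ! i\<close> and is a combination of the indicators of
  that letter.\<close>

lemma query_span_query_op:
  assumes "finite H" "q < state_dim H n w" "r < state_dim H n w"
    and "query_span (inputs H n) ({..<n} \<times> H) t F"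
  shows "query_span (inputs H n) ({..<n} \<times> H) (Suc t) (\<lambda>Y. query_op H n w Y $$ (r, q) * F Y)"
proof -
  from assms(2) obtain i a z where q: "i < n" "basis_label H w q = (i, a, z)"
    by (rule basis_labelE)
  \<comment> \<open>The matrix entry in case the letter at position \<open>i\<close> is
    \<open>h\<close>.\<close>
  define e :: "'a \<Rightarrow> complex" where
    "e h = of_bool (r = (i * card H + (a + to_nat_on H h) mod card H) * w + z)" for h
  have "query_span (inputs H n) ({..<n} \<times> H) (Suc t)
      (\<lambda>Y. \<Sum>h\<in>H. e h * (of_bool (Y ! i = h) * F Y))"
    using q(1) by (intro query_span_sum query_span_cmult query_span.query[OF assms(4)]) simp
  then show ?thesis
  proof (rule query_span.cong)
    fix Y assume "Y \<in> inputs H n"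
    then have "Y ! i \<in> H"
      using q(1) by (auto simp: inputs_def)
    have "(\<Sum>h\<in>H. e h * (of_bool (Y ! i = h) * F Y)) = (\<Sum>h\<in>H. if Y ! i = h then e h * F Y else 0)"
      by (intro sum.cong) auto
    also have "\<dots> = e (Y ! i) * F Y"
      using assms(1) \<open>Y ! i \<in> H\<close> by simp
    also have "\<dots> = query_op H n w Y $$ (r, q) * F Y"
      using query_op_entry[OF assms(3,2)] q(2) by (simp add: e_def query_target_def)
    finally show "(\<Sum>h\<in>H. e h * (of_bool (Y ! i = h) * F Y)) = query_op H n w Y $$ (r, q) * F Y" .
  qed
qed

text \<open>The polynomial method: gates contribute coefficients independent of the input, and each
  query raises the degree by at most one.\<close>

lemma query_span_state_after:
  assumes "finite H" "query_alg_on H n A" "t \<le> num_queries A" "r < state_dim H n (work_dim A)"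
  shows "query_span (inputs H n) ({..<n} \<times> H) t (\<lambda>Y. state_after H n A Y t $ r)"
  using assms(3,4)
proof (induction t arbitrary: r)
  case 0
  show ?case
    by (simp only: state_after.simps query_span.const)
next
  case (Suc t)
  define d where "d = state_dim H n (work_dim A)"
  have gate: "gate A (Suc t) \<in> carrier_mat d d"
    using assms(2) Suc.prems by (auto simp: query_alg_on_def unitary_mat_def d_def)
  have "query_span (inputs H n) ({..<n} \<times> H) (Suc t) (\<lambda>Y. \<Sum>s<d. gate A (Suc t) $$ (r, s) *
      (\<Sum>q<d. query_op H n (work_dim A) Y $$ (s, q) * state_after H n A Y t $ q))"
    using Suc.prems
    by (intro query_span_sum query_span_cmult query_span_query_op Suc.IH assms(1)) (auto simp: d_def)
  then show ?case
  proof (rule query_span.cong)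
    fix Y
    have state: "state_after H n A Y t \<in> carrier_vec d"
      unfolding d_def using assms(2) Suc.prems by (intro state_after_carrier) auto
    have query: "query_op H n (work_dim A) Y \<in> carrier_mat d d"
      by (simp add: d_def)
    have "state_after H n A Y (Suc t) $ r = (\<Sum>s<d. gate A (Suc t) $$ (r, s) *
        (query_op H n (work_dim A) Y *\<^sub>v state_after H n A Y t) $ s)"
      unfolding state_after.simps using Suc.prems(2)
      by (intro mult_mat_vec_index_sum[OF gate mult_mat_vec_carrier[OF query state]]) (simp add: d_def)
    also have "\<dots> = (\<Sum>s<d. gate A (Suc t) $$ (r, s) *
        (\<Sum>q<d. query_op H n (work_dim A) Y $$ (s, q) * state_after H n A Y t $ q))"
      using mult_mat_vec_index_sum[OF query state] by (intro sum.cong refl) simp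
    finally show "(\<Sum>s<d. gate A (Suc t) $$ (r, s) *
        (\<Sum>q<d. query_op H n (work_dim A) Y $$ (s, q) * state_after H n A Y t $ q)) =
        state_after H n A Y (Suc t) $ r"
      by (rule sym)
  qed
qed

text \<open>A squared modulus is an amplitude times its conjugate, which doubles the degree.\<close>

lemma query_span_output_prob:
  assumes "finite H" "query_alg_on H n A"
  shows "query_span (inputs H n) ({..<n} \<times> H) (num_queries A + num_queries A)
    (\<lambda>Y. complex_of_real (output_prob H n A Y b))"
proof -
  have "(\<lambda>Y. complex_of_real (output_prob H n A Y b)) =
      (\<lambda>Y. \<Sum>r | r < state_dim H n (work_dim A) \<and> (r \<in> accepting A \<longleftrightarrow> b).
        state_after H n A Y (num_queries A) $ r * cnj (state_after H n A Y (num_queries A) $ r))"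
    by (simp add: output_prob_def complex_norm_square del: of_real_power)
  then show ?thesis
    by (simp only:) (intro query_span_sum query_span_mult query_span_cnj query_span_state_after assms; simp)
qed

text \<open>
  If the sign of a relation \<open>l\<close> among the functions spanned by \<open>2 * T\<close> queries were computable with
  \<open>T\<close> queries, then \<open>l\<close> would be positively correlated with the bias of the output.
\<close>

lemma sign_of_relation_query_bound:
  fixes l :: "'h list \<Rightarrow> real"
  assumes "finite H" "finite E" "E \<subseteq> inputs H n"
    and rel: "\<And>\<alpha>. set \<alpha> \<subseteq> {..<n} \<times> H \<Longrightarrow> length \<alpha> \<le> 2 * T \<Longrightarrow>
      (\<Sum>Y\<in>E. l Y * of_bool (monomial \<alpha> Y)) = 0"
    and nontrivial: "\<exists>Y\<in>E. l Y \<noteq> 0"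
    and f: "\<And>Y. Y \<in> E \<Longrightarrow> f Y = Some (l Y > 0)"
    and A: "computes_bounded_error H n f A"
    and "n > 0"
  shows "T < num_queries A"
proof (rule ccontr)
  assume "\<not> T < num_queries A"
  have alg: "query_alg_on H n A"
    using A by (simp add: computes_bounded_error_def)
  \<comment> \<open>The relation is real so that its values have signs, but amplitudes are complex;
    the relation is therefore carried over.\<close>
  have rel': "(\<Sum>Y\<in>E. complex_of_real (l Y) * of_bool (monomial \<alpha> Y)) = 0"
    if "set \<alpha> \<subseteq> {..<n} \<times> H" "length \<alpha> \<le> 2 * T" for \<alpha>
  proof -
    have "complex_of_real (\<Sum>Y\<in>E. l Y * of_bool (monomial \<alpha> Y)) = 0"
      using rel[OF that] by simp
    moreover have "complex_of_real (of_bool P) = of_bool P" for P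
      by (cases P) auto
    ultimately show ?thesis
      by simp
  qed
  have orth: "(\<Sum>Y\<in>E. l Y * output_prob H n A Y b) = 0" for b
  proof -
    have "(\<Sum>Y\<in>E. complex_of_real (l Y) *
        (of_bool (monomial [] Y) * complex_of_real (output_prob H n A Y b))) = 0"
      using query_span_orthogonal[OF query_span_output_prob[OF assms(1) alg] assms(3) rel', of "2 * T" "[]"]
        \<open>\<not> T < num_queries A\<close> by simp
    then have "complex_of_real (\<Sum>Y\<in>E. l Y * output_prob H n A Y b) = 0"
      by (simp add: monomial_def)
    then show ?thesis
      by (simp only: of_real_eq_0_iff)
  qed
  define bias where "bias Y = output_prob H n A Y True - output_prob H n A Y False" for Y
  from nontrivial obtain Z where Z: "Z \<in> E" "l Z \<noteq> 0"
    by blast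
  \<comment> \<open>A word of positive length has a letter; this makes the state space nonzero and
    the two output probabilities sum to 1.\<close>
  then have "H \<noteq> {}"
    using assms(3,8) by (auto simp: inputs_def)
  then have "0 < state_dim H n (work_dim A)"
    using assms(1,8) alg by (simp add: state_dim_def query_alg_on_def card_gt_0_iff)
  then have total: "output_prob H n A Y True + output_prob H n A Y False = 1" for Y
    using alg by (intro output_prob_True_plus_False)
  \<comment> \<open>A word with \<open>l Y = 0\<close> has the label \<open>False\<close> and
    negative bias, but its term in the sum below vanishes.\<close>
  have bias: "if l Y > 0 then bias Y > 0 else bias Y < 0" if "Y \<in> E" for Y
  proof -
    have "output_prob H n A Y (l Y > 0) \<ge> 2/3"
      using A f[OF that] by (auto simp: computes_bounded_error_def dom_def)
    then show ?thesis
      using total[of Y] by (cases "l Y > 0") (auto simp: bias_def)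
  qed
  have "0 < (\<Sum>Y\<in>E. l Y * bias Y)"
  proof (rule sum_pos2[OF assms(2) Z(1)])
    show "0 < l Z * bias Z"
      using bias[OF Z(1)] Z(2) by (auto simp: zero_less_mult_iff split: if_splits)
    show "0 \<le> l Y * bias Y" if "Y \<in> E" for Y
      using bias[OF that] by (auto simp: zero_le_mult_iff split: if_splits)
  qed
  also have "(\<Sum>Y\<in>E. l Y * bias Y) = 0"
    using orth by (simp add: bias_def right_diff_distrib sum_subtractf)
  finally show False
    by simp
qed

text \<open>The left side of \<open>many\<close> counts the monomials of degree at most
  \<open>2 * T\<close>; with fewer equations than words a nonzero relation exists. \<open>L\<close>
  is fixed before \<open>A\<close>, so one labelling defeats all algorithms, and \<open>f\<close> is
  constrained only on \<open>E\<close>, so it may be extended to rearranged words.\<close>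

lemma ex_hard_labelling:
  assumes "finite H" "finite E" "E \<subseteq> inputs H n" "n > 0"
    and many: "(\<Sum>i\<le>2 * T. (n * card H) ^ i) < card E"
  shows "\<exists>L. \<forall>f A. (\<forall>Y\<in>E. f Y = Some (L Y)) \<longrightarrow> computes_bounded_error H n f A \<longrightarrow> T < num_queries A"
proof -
  let ?J = "{\<alpha>. set \<alpha> \<subseteq> {..<n} \<times> H \<and> length \<alpha> \<le> 2 * T}"
  have fin: "finite ({..<n} \<times> H)"
    using assms(1) by simp
  have "finite ?J" "card ?J < card E"
    using finite_lists_length_le[OF fin, of "2 * T"] card_lists_length_le[OF fin, of "2 * T"] many
    by (simp_all add: card_cartesian_product)
  then obtain l :: "'a list \<Rightarrow> real" where l: "\<exists>Y\<in>E. l Y \<noteq> 0"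
      "\<forall>\<alpha>\<in>?J. (\<Sum>Y\<in>E. l Y * of_bool (monomial \<alpha> Y)) = 0"
    using nontrivial_relation[of ?J E "\<lambda>\<alpha> Y. of_bool (monomial \<alpha> Y) :: real"] assms(2) by blast
  have rel: "(\<Sum>Y\<in>E. l Y * of_bool (monomial \<alpha> Y)) = 0"
    if "set \<alpha> \<subseteq> {..<n} \<times> H" "length \<alpha> \<le> 2 * T" for \<alpha>
    using l(2) that by blast
  have "T < num_queries A"
    if "\<forall>Y\<in>E. f Y = Some (l Y > 0)" "computes_bounded_error H n f A" for f A
    using that(1) by (intro sign_of_relation_query_bound[OF assms(1-3) rel l(1) _ that(2) assms(4)]) auto
  then show ?thesis
    by (intro exI[of _ "\<lambda>Y. l Y > 0"]) blast
qed

section \<open>A verifier with one query\<close>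

text \<open>Supplies the gate that prepares a given real unit vector \<open>u\<close>: the
  reflection exchanging the first basis vector with \<open>u\<close>. It is real, symmetric and its
  own inverse, hence unitary. If \<open>u 0\<close> were 1, the two vectors would coincide and
  define no reflection.\<close>

lemma householder:
  fixes u :: "nat \<Rightarrow> real"
  assumes "d > 0" and norm: "(\<Sum>r<d. (u r)\<^sup>2) = 1" and "u 0 \<noteq> 1"
  shows "\<exists>U. unitary_mat d U \<and> (\<forall>r<d. (U *\<^sub>v unit_vec d 0) $ r = complex_of_real (u r))"
proof -
  define \<delta> :: "nat \<Rightarrow> nat \<Rightarrow> real" where "\<delta> r s = of_bool (r = s)" for r s
  define v where "v r = \<delta> r 0 - u r" for r
  define \<beta> where "\<beta> = 1 - u 0"
  \<comment> \<open>Since \<open>v\<close> has squared norm \<open>2 * \<beta>\<close>, dividing by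
    \<open>\<beta>\<close> is the usual factor 2 over the squared norm.\<close>
  define e where "e r s = \<delta> r s - v r * v s / \<beta>" for r s
  define U where "U = mat d d (\<lambda>(r, s). complex_of_real (e r s))"
  have U_carrier: "U \<in> carrier_mat d d"
    by (simp add: U_def)
  have \<delta>_sum: "(\<Sum>s<d. \<delta> s r * g s) = g r" if "r < d" for g r
  proof -
    have "(\<Sum>s<d. \<delta> s r * g s) = (\<Sum>s<d. if s = r then g s else 0)"
      by (intro sum.cong) (auto simp: \<delta>_def)
    then show ?thesis
      using that by simp
  qed
  have \<delta>_commute: "\<delta> r s = \<delta> s r" for r s
    by (auto simp: \<delta>_def)
  have e_commute: "e r s = e s r" for r s
    by (simp add: e_def \<delta>_commute[of r s] mult.commute)
  have "\<beta> \<noteq> 0"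
    using assms(3) by (simp add: \<beta>_def)
  have "(\<Sum>s<d. v s * v s) = (\<Sum>s<d. \<delta> s 0 * (\<delta> s 0 - 2 * u s) + (u s)\<^sup>2)"
    by (intro sum.cong) (simp_all add: v_def power2_eq_square algebra_simps)
  also have "\<dots> = \<delta> 0 0 - 2 * u 0 + 1"
    using assms(1) norm by (simp add: sum.distrib \<delta>_sum)
  finally have v_norm: "(\<Sum>s<d. v s * v s) = 2 * \<beta>"
    by (simp add: \<delta>_def \<beta>_def)
  have e_e: "(\<Sum>k<d. e r k * e k s) = \<delta> r s" if "r < d" "s < d" for r s
  proof -
    have "(\<Sum>k<d. e r k * e k s) = (\<Sum>k<d. \<delta> k r * e k s - \<delta> k s * (v r * v k / \<beta>) +
        v r * v s / (\<beta> * \<beta>) * (v k * v k))"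
      by (intro sum.cong) (simp_all add: e_def \<delta>_commute[of r] algebra_simps)
    also have "\<dots> = e r s - v r * v s / \<beta> + v r * v s / (\<beta> * \<beta>) * (\<Sum>k<d. v k * v k)"
      using that by (simp only: sum.distrib sum_subtractf \<delta>_sum sum_distrib_left)
    also have "\<dots> = \<delta> r s"
      using \<open>\<beta> \<noteq> 0\<close> by (simp add: v_norm e_def field_simps)
    finally show ?thesis .
  qed
  have "U * U = 1\<^sub>m d"
  proof (intro eq_matI)
    fix r s assume rs: "r < dim_row (1\<^sub>m d :: complex mat)" "s < dim_col (1\<^sub>m d :: complex mat)"
    then have "(U * U) $$ (r, s) = (\<Sum>k<d. complex_of_real (e r k * e k s))"
      by (auto simp: U_def scalar_prod_def atLeast0LessThan intro!: sum.cong)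
    also have "\<dots> = complex_of_real (\<delta> r s)"
      using rs e_e by (simp only: of_real_sum[symmetric]) simp
    finally show "(U * U) $$ (r, s) = 1\<^sub>m d $$ (r, s)"
      using rs by (simp add: \<delta>_def)
  qed (simp_all add: U_def)
  moreover have "mat_adjoint U = U"
  proof (intro eq_matI)
    fix r s assume "r < dim_row U" "s < dim_col U"
    then have rs: "r < d" "s < d"
      by (simp_all add: U_def)
    then have "mat_adjoint U $$ (r, s) = cnj (U $$ (s, r))"
      by (rule mat_adjoint_entry[OF U_carrier])
    then show "mat_adjoint U $$ (r, s) = U $$ (r, s)"
      using rs by (simp add: U_def e_commute[of r s])
  qed (use mat_adjoint_carrier[OF U_carrier] U_carrier in simp_all)
  moreover have "(U *\<^sub>v unit_vec d 0) $ r = complex_of_real (u r)" if "r < d" for r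
  proof -
    have "(U *\<^sub>v unit_vec d 0) $ r = (\<Sum>s<d. U $$ (r, s) * unit_vec d 0 $ s)"
      by (rule mult_mat_vec_index_sum[OF U_carrier unit_vec_carrier that])
    also have "\<dots> = (\<Sum>s<d. if s = 0 then complex_of_real (e r s) else 0)"
      using that by (intro sum.cong) (auto simp: U_def)
    also have "\<dots> = complex_of_real (e r 0)"
      using assms(1) by simp
    also have "v 0 = \<beta>"
      by (simp add: v_def \<delta>_def \<beta>_def)
    then have "e r 0 = u r"
      using \<open>\<beta> \<noteq> 0\<close> by (simp add: e_def) (simp add: v_def)
    finally show ?thesis .
  qed
  ultimately show ?thesis
    using U_carrier by (auto simp: unitary_mat_def)
qed

lemma sum_multiples:
  fixes g :: "nat \<Rightarrow> real"
  assumes "m > 0"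
  shows "(\<Sum>s<n * m. if s mod m = 0 then g (s div m) else 0) = (\<Sum>i<n. g i)"
proof -
  have "(\<Sum>s<n * m. if s mod m = 0 then g (s div m) else 0) = (\<Sum>s\<in>(\<lambda>i. i * m) ` {..<n}. g (s div m))"
  proof (rule sum.mono_neutral_cong_right)
    show "\<forall>s\<in>{..<n * m} - (\<lambda>i. i * m) ` {..<n}. (if s mod m = 0 then g (s div m) else 0) = 0"
    proof
      fix s assume s: "s \<in> {..<n * m} - (\<lambda>i. i * m) ` {..<n}"
      then have "s div m < n"
        by (simp add: less_mult_imp_div_less)
      with s have "s \<noteq> s div m * m"
        by blast
      then show "(if s mod m = 0 then g (s div m) else 0) = 0"
        using div_mult_mod_eq[of s m] by auto
    qed
  qed (use assms in auto)
  also have "\<dots> = (\<Sum>i<n. g i)"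
    using assms by (subst sum.reindex) (auto simp: inj_on_def)
  finally show ?thesis .
qed

text \<open>The first gate prepares the uniform superposition of all positions with answer register
  0. After the query, measuring yields the letter at a uniformly random position.\<close>

lemma ex_sampling_alg:
  assumes "finite H" "n \<ge> 2" "X \<in> inputs H n"
  shows "\<exists>A. query_alg_on H n A \<and> num_queries A = 1 \<and> (\<forall>Y\<in>inputs H n. \<forall>b.
    output_prob H n A Y b = card {i. i < n \<and> (Y ! i \<in> set X \<longleftrightarrow> b)} / n)"
proof -
  define m where "m = card H"
  define d where "d = n * m"
  define u :: "nat \<Rightarrow> real" where "u s = (if s mod m = 0 then 1 / sqrt n else 0)" for s
  have "H \<noteq> {}"
    using assms by (auto simp: inputs_def)
  then have "m > 0"
    using assms(1) by (simp add: m_def card_gt_0_iff)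
  have d: "state_dim H n 1 = d"
    by (simp add: state_dim_def m_def d_def)
  have u_sq: "(u s)\<^sup>2 = (if s mod m = 0 then 1 / n else 0)" for s
    by (simp add: u_def power_divide)
  have "(\<Sum>r<d. (u r)\<^sup>2) = (\<Sum>i<n. 1 / n)"
    unfolding u_sq d_def by (rule sum_multiples[OF \<open>m > 0\<close>])
  then have "(\<Sum>r<d. (u r)\<^sup>2) = 1"
    using assms(2) by simp
  \<comment> \<open>Here \<open>n \<ge> 2\<close> enters: for a single position the amplitude would
    be 1.\<close>
  moreover have "u 0 \<noteq> 1"
    using assms(2) by (simp add: u_def)
  moreover have "0 < d"
    using assms(2) \<open>m > 0\<close> by (simp add: d_def)
  ultimately obtain U where U: "unitary_mat d U"
      "\<And>r. r < d \<Longrightarrow> (U *\<^sub>v unit_vec d 0) $ r = complex_of_real (u r)"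
    using householder[of d u] by blast
  have U_carrier: "U \<in> carrier_mat d d"
    using U(1) by (simp add: unitary_mat_def)
  \<comment> \<open>One query lies between two gates, and the second gate is the identity. As
    \<open>work_dim\<close> is 1, \<open>r mod m\<close> is the answer register, which has become
    the number of the queried letter.\<close>
  define A where "A = \<lparr>work_dim = 1, num_queries = 1, gate = (\<lambda>t. if t = 0 then U else 1\<^sub>m d),
    accepting = {r. r mod m \<in> to_nat_on H ` set X}\<rparr>"
  have "mat_adjoint (1\<^sub>m d) = (1\<^sub>m d :: complex mat)"
  proof (intro eq_matI)
    fix r s assume "r < dim_row (1\<^sub>m d :: complex mat)" "s < dim_col (1\<^sub>m d :: complex mat)"
    then show "mat_adjoint (1\<^sub>m d) $$ (r, s) = (1\<^sub>m d :: complex mat) $$ (r, s)"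
      using mat_adjoint_entry[OF one_carrier_mat, of r d s] by simp
  qed (use mat_adjoint_carrier[OF one_carrier_mat, of d] in auto)
  then have "unitary_mat d (1\<^sub>m d)"
    by (simp add: unitary_mat_def)
  then have "query_alg_on H n A"
    using U(1) d by (simp add: query_alg_on_def A_def)
  moreover have "output_prob H n A Y b = card {i. i < n \<and> (Y ! i \<in> set X \<longleftrightarrow> b)} / n"
    if Y: "Y \<in> inputs H n" for Y b
  proof -
    define \<phi> where "\<phi> = U *\<^sub>v unit_vec d 0"
    have \<phi>: "\<phi> \<in> carrier_vec d"
      unfolding \<phi>_def by (rule mult_mat_vec_carrier[OF U_carrier unit_vec_carrier])
    define \<psi> where "\<psi> = query_op H n 1 Y *\<^sub>v \<phi>"
    have "\<psi> \<in> carrier_vec d"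
      using mult_mat_vec_carrier[OF query_op_carrier[of H n 1 Y], of \<phi>] \<phi>
      by (simp only: \<psi>_def d)
    moreover have "state_after H n A Y (Suc 0) = 1\<^sub>m d *\<^sub>v \<psi>"
      unfolding state_after.simps \<psi>_def \<phi>_def by (simp only: A_def d query_alg.simps) simp
    ultimately have final: "state_after H n A Y (Suc 0) = \<psi>"
      by simp
    let ?t = "query_target H 1 Y"
    have bij: "bij_betw ?t {..<d} {..<d}"
      using bij_betw_query_target[of H 1 Y n] by (simp only: d)
    have "output_prob H n A Y b = (\<Sum>r\<in>{r. r < d \<and> (r \<in> accepting A \<longleftrightarrow> b)}. (cmod (\<psi> $ r))\<^sup>2)"
      using final d by (simp add: output_prob_def A_def)
    also have "\<dots> = (\<Sum>r<d. if r \<in> accepting A \<longleftrightarrow> b then (cmod (\<psi> $ r))\<^sup>2 else 0)"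
      by (intro sum.mono_neutral_cong_left) auto
    \<comment> \<open>Reindexing along the query permutation pulls the amplitudes back to the
      prepared state, which is supported on the multiples of \<open>m\<close>.\<close>
    also have "\<dots> = (\<Sum>s<d. if ?t s \<in> accepting A \<longleftrightarrow> b then (cmod (\<psi> $ ?t s))\<^sup>2 else 0)"
      by (rule sum.reindex_bij_betw[OF bij, symmetric])
    also have "\<dots> = (\<Sum>s<d. if s mod m = 0 then
        (if Y ! (s div m) \<in> set X \<longleftrightarrow> b then 1 / n else 0) else 0)"
    proof (intro sum.cong refl)
      fix s assume "s \<in> {..<d}"
      then have "s < d"
        by simp
      then have amplitude: "\<psi> $ ?t s = complex_of_real (u s)"
        using query_op_mult_vec[of \<phi> H n 1 s Y] \<phi> U(2) unfolding d \<psi>_def \<phi>_def by simp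
      have target: "?t s \<in> accepting A \<longleftrightarrow> Y ! (s div m) \<in> set X" if "s mod m = 0"
      proof -
        have "s div m < n"
          using \<open>s < d\<close> by (simp add: less_mult_imp_div_less d_def)
        then have mem: "Y ! (s div m) \<in> H" "set X \<subseteq> H"
          using Y assms(3) by (auto simp: inputs_def)
        have "to_nat_on H (Y ! (s div m)) < m"
          using to_nat_on_finite[OF assms(1)] mem(1) by (auto simp: bij_betw_def m_def)
        then have "?t s mod m = to_nat_on H (Y ! (s div m))"
          using that by (simp add: query_target_def basis_label_def flip: m_def)
        then show ?thesis
          using inj_on_image_mem_iff[OF inj_on_to_nat_on[OF countable_finite[OF assms(1)]] mem]
          by (simp add: A_def)
      qed
      show "(if ?t s \<in> accepting A \<longleftrightarrow> b then (cmod (\<psi> $ ?t s))\<^sup>2 else 0) =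
          (if s mod m = 0 then (if Y ! (s div m) \<in> set X \<longleftrightarrow> b then 1 / n else 0) else 0)"
        unfolding amplitude using u_sq[of s] target by (cases "s mod m = 0") simp_all
    qed
    also have "\<dots> = (\<Sum>i<n. if Y ! i \<in> set X \<longleftrightarrow> b then 1 / n else 0)"
      unfolding d_def by (rule sum_multiples[OF \<open>m > 0\<close>])
    also have "\<dots> = (\<Sum>i\<in>{i. i < n \<and> (Y ! i \<in> set X \<longleftrightarrow> b)}. 1 / n)"
      by (intro sum.mono_neutral_cong_right) auto
    also have "\<dots> = card {i. i < n \<and> (Y ! i \<in> set X \<longleftrightarrow> b)} / n"
      by simp
    finally show ?thesis .
  qed
  ultimately show ?thesis
    by (intro exI[of _ A]) (simp add: A_def)
qed

text \<open>Sampling one letter and testing membership in \<open>set X\<close> always accepts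
  \<open>X\<close>, and at least half of the letters of a \<open>Y\<close> with another value fail
  the test.\<close>

lemma QC_at_le_1:
  assumes "finite H" "n \<ge> 2" "dom f \<subseteq> inputs H n" "X \<in> dom f"
    and far: "\<And>Y. Y \<in> dom f \<Longrightarrow> f Y \<noteq> f X \<Longrightarrow> 2 * length (filter (\<lambda>h. h \<in> set X) Y) \<le> n"
  shows "QC_at H n f X \<le> 1"
proof -
  have X: "X \<in> inputs H n"
    using assms(3,4) by blast
  obtain A where A: "query_alg_on H n A" "num_queries A = 1"
      "\<And>Y b. Y \<in> inputs H n \<Longrightarrow> output_prob H n A Y b = card {i. i < n \<and> (Y ! i \<in> set X \<longleftrightarrow> b)} / n"
    using ex_sampling_alg[OF assms(1,2) X] by blast
  have "{i. i < n \<and> (X ! i \<in> set X \<longleftrightarrow> True)} = {..<n}"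
    using X by (auto simp: inputs_def)
  then have "output_prob H n A X True = 1"
    using A(3)[OF X, of True] assms(2) by simp
  moreover have "output_prob H n A Y False \<ge> 1/2" if Y: "Y \<in> dom f" "f Y \<noteq> f X" for Y
  proof -
    have len: "length Y = n" "Y \<in> inputs H n"
      using Y(1) assms(3) by (auto simp: inputs_def)
    have "length (filter (\<lambda>h. h \<in> set X) Y) + length (filter (\<lambda>h. h \<notin> set X) Y) = n"
      using sum_length_filter_compl[of "\<lambda>h. h \<in> set X" Y] len by simp
    then have "n \<le> 2 * length (filter (\<lambda>h. h \<notin> set X) Y)"
      using far[OF Y] by simp
    also have "length (filter (\<lambda>h. h \<notin> set X) Y) = card {i. i < n \<and> (Y ! i \<in> set X \<longleftrightarrow> False)}"
      by (simp add: length_filter_conv_card len)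
    finally have "real n \<le> 2 * real (card {i. i < n \<and> (Y ! i \<in> set X \<longleftrightarrow> False)})"
      by linarith
    then have "1/2 \<le> card {i. i < n \<and> (Y ! i \<in> set X \<longleftrightarrow> False)} / real n"
      using assms(2) by (simp add: field_simps)
    then show ?thesis
      by (simp only: A(3)[OF len(2)])
  qed
  ultimately have "quantum_verifier H n f X A"
    using A(1) by (simp add: quantum_verifier_def)
  then show ?thesis
    unfolding QC_at_def using A(2) by (intro INF_lower2[of A]) (auto simp: one_enat_def)
qed

section \<open>Functions from codes with large distance\<close>

text \<open>The distance condition counts common letters rather than agreeing positions, so it
  depends only on multisets and survives closing the code under permutations.\<close>

lemma ex_function_of_far_code:
  assumes "finite H" "finite E" "E \<subseteq> inputs H n" "n \<ge> 2"
    and far: "\<And>Z Z'. Z \<in> E \<Longrightarrow> Z' \<in> E \<Longrightarrow> Z \<noteq> Z' \<Longrightarrow> 2 * length (filter (\<lambda>h. h \<in> set Z) Z') \<le> n"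
    and many: "(\<Sum>i\<le>2 * T. (n * card H) ^ i) < card E"
  shows "\<exists>f. dom f \<subseteq> inputs H n \<and> symmetric_pfun n f \<and> QC H n f \<le> 1 \<and> enat (Suc T) \<le> Q2 H n f"
proof -
  have "0 < n"
    using assms(4) by simp
  obtain L where L: "\<And>f A. \<forall>Y\<in>E. f Y = Some (L Y) \<Longrightarrow> computes_bounded_error H n f A \<Longrightarrow> T < num_queries A"
    using ex_hard_labelling[OF assms(1-3) \<open>0 < n\<close> many] by blast
  \<comment> \<open>The inner existential is the label of the only code word with this multiset, by
    \<open>code_unique\<close>.\<close>
  define f where "f Y = (if \<exists>Z\<in>E. mset Y = mset Z then Some (\<exists>Z\<in>E. mset Y = mset Z \<and> L Z) else None)" for Y
  have length_filter_mset: "length (filter P Y) = length (filter P Z)" if "mset Y = mset Z"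
    for P and Y Z :: "'a list"
    using that by (metis mset_filter size_mset)
  \<comment> \<open>Rearrangements of each other share all \<open>n\<close> letters, which exceeds
    \<open>n / 2\<close>.\<close>
  have code_unique: "Z = Z'" if "Z \<in> E" "Z' \<in> E" "mset Z = mset Z'" for Z Z'
  proof (rule ccontr)
    assume "Z \<noteq> Z'"
    then have "2 * length (filter (\<lambda>h. h \<in> set Z) Z') \<le> n"
      using far that by blast
    moreover have "filter (\<lambda>h. h \<in> set Z) Z' = Z'"
      using that(3) by (intro filter_True) (auto dest: mset_eq_setD)
    moreover have "length Z' = n"
      using that assms(3) by (auto simp: inputs_def)
    ultimately show False
      using assms(4) by simp
  qed
  have f_eq: "f Y = Some (L Z)" if "Z \<in> E" "mset Y = mset Z" for Y Z
    using that code_unique by (auto simp: f_def)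
  have domD: "\<exists>Z\<in>E. mset Y = mset Z" if "Y \<in> dom f" for Y
    using that by (auto simp: f_def dom_def split: if_splits)
  have f_mset: "f Y = f Z" if "mset Y = mset Z" for Y Z
    using that by (simp add: f_def)
  have dom: "dom f \<subseteq> inputs H n"
  proof
    fix Y assume "Y \<in> dom f"
    then obtain Z where Z: "Z \<in> E" "mset Y = mset Z"
      using domD by blast
    from this(2) have "set Y = set Z" "length Y = length Z"
      by (auto dest: mset_eq_setD mset_eq_length)
    then show "Y \<in> inputs H n"
      using Z(1) assms(3) by (auto simp: inputs_def)
  qed
  moreover have "symmetric_pfun n f"
    unfolding symmetric_pfun_def
  proof (intro allI impI ballI)
    fix \<sigma> Y assume "\<sigma> permutes {..<n}" and Y: "Y \<in> dom f"
    then have "mset (permute_list \<sigma> Y) = mset Y"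
      using dom by (intro mset_permute_list) (auto simp: inputs_def)
    then have "f (permute_list \<sigma> Y) = f Y"
      by (rule f_mset)
    with Y show "permute_list \<sigma> Y \<in> dom f \<and> f (permute_list \<sigma> Y) = f Y"
      by (simp add: dom_def)
  qed
  moreover have "QC H n f \<le> 1"
    unfolding QC_def
  proof (intro SUP_least QC_at_le_1[OF assms(1,4) dom])
    fix X Y assume X: "X \<in> dom f" and Y: "Y \<in> dom f" "f Y \<noteq> f X"
    from X obtain Z where Z: "Z \<in> E" "mset X = mset Z"
      using domD by blast
    from Y obtain Z' where Z': "Z' \<in> E" "mset Y = mset Z'"
      using domD by blast
    have "Z \<noteq> Z'"
      using Y(2) f_eq[OF Z] f_eq[OF Z'] by auto
    have "length (filter (\<lambda>h. h \<in> set X) Y) = length (filter (\<lambda>h. h \<in> set Z) Z')"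
      using length_filter_mset[OF Z'(2)] mset_eq_setD[OF Z(2)] by simp
    then show "2 * length (filter (\<lambda>h. h \<in> set X) Y) \<le> n"
      using far[OF Z(1) Z'(1) \<open>Z \<noteq> Z'\<close>] by simp
  qed
  moreover have "enat (Suc T) \<le> Q2 H n f"
    unfolding Q2_def
  proof (rule INF_greatest)
    fix A assume "A \<in> {A. computes_bounded_error H n f A}"
    then have "T < num_queries A"
      using f_eq by (intro L[of f A]) auto
    then show "enat (Suc T) \<le> enat (num_queries A)"
      by simp
  qed
  ultimately show ?thesis
    by blast
qed

section \<open>Integer Reed-Solomon code\<close>

text \<open>
  Over the integers no prime field is needed: the values may be as large as the number of coefficient
  choices times \<open>n ^ k\<close>, because only the ratio of the logarithms of code and alphabet size matters.
\<close>

definition int_poly :: "nat list \<Rightarrow> nat \<Rightarrow> nat" where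
  "int_poly c x = (\<Sum>j<length c. c ! j * x ^ j)"

text \<open>\<open>prod_encode\<close> packs position and value into one number, so that the
  alphabet is a set of naturals.\<close>

definition code_word :: "nat \<Rightarrow> nat list \<Rightarrow> nat list" where
  "code_word n c = map (\<lambda>i. prod_encode (i, int_poly c i)) [0..<n]"

text \<open>Each new term is at most the bound reached so far, and \<open>2 \<le> n\<close> lets the
  next factor \<open>n\<close> absorb the doubling.\<close>

lemma int_poly_less:
  assumes "set c \<subseteq> {..<B}" "x < n" "2 \<le> n" "0 < B"
  shows "int_poly c x < B * n ^ length c"
  using assms(1)
proof (induction c rule: rev_induct)
  case Nil
  then show ?case
    using assms(4) by (simp add: int_poly_def)
next
  case (snoc a c)
  have "int_poly (c @ [a]) x = int_poly c x + a * x ^ length c"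
    by (simp add: int_poly_def nth_append)
  also have "\<dots> < B * n ^ length c + B * n ^ length c"
    using snoc assms(2) by (intro add_less_le_mono mult_le_mono power_mono) auto
  also have "\<dots> = 2 * (B * n ^ length c)"
    by simp
  also have "\<dots> \<le> n * (B * n ^ length c)"
    using assms(3) by (rule mult_le_mono1)
  finally show ?case
    by (simp add: mult_ac)
qed

text \<open>The difference is a nonzero real polynomial of degree at most \<open>g\<close>, which
  has at most \<open>g\<close> roots.\<close>

lemma card_int_poly_agree:
  assumes "length c = Suc g" "length c' = Suc g" "c \<noteq> c'"
  shows "card {i. i < n \<and> int_poly c i = int_poly c' i} \<le> g"
proof -
  define a where "a j = real (c ! j) - real (c' ! j)" for j
  let ?R = "{z. (\<Sum>j\<le>g. a j * z ^ j) = 0}"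
  obtain j where "j \<le> g" "c ! j \<noteq> c' ! j"
    using assms by (metis nth_equalityI less_Suc_eq_le)
  then have R: "finite ?R \<and> card ?R \<le> g"
    by (intro polyfun_rootbound[of a j]) (auto simp: a_def)
  have "real ` {i. i < n \<and> int_poly c i = int_poly c' i} \<subseteq> ?R"
  proof (rule image_subsetI)
    fix i assume i: "i \<in> {i. i < n \<and> int_poly c i = int_poly c' i}"
    have "(\<Sum>j\<le>g. a j * real i ^ j) = real (int_poly c i) - real (int_poly c' i)"
      using assms by (simp add: int_poly_def a_def lessThan_Suc_atMost left_diff_distrib sum_subtractf)
    then show "real i \<in> ?R"
      using i by simp
  qed
  then have "card (real ` {i. i < n \<and> int_poly c i = int_poly c' i}) \<le> g"
    using R card_mono[of ?R] by (meson order_trans)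
  then show ?thesis
    by (simp add: card_image)
qed

text \<open>A letter carries its position, so a common letter is an agreement of the two polynomials
  at the same point.\<close>

lemma code_word_far:
  assumes "length c = Suc g" "length c' = Suc g" "c \<noteq> c'"
  shows "length (filter (\<lambda>h. h \<in> set (code_word n c)) (code_word n c')) \<le> g"
proof -
  have "{i. i < n \<and> code_word n c' ! i \<in> set (code_word n c)} = {i. i < n \<and> int_poly c i = int_poly c' i}"
    by (auto simp: code_word_def image_iff)
  then show ?thesis
    using card_int_poly_agree[OF assms, of n] by (simp add: length_filter_conv_card code_word_def[of n c'])
qed

lemma sum_power_less:
  fixes m :: nat
  assumes "2 \<le> m"
  shows "(\<Sum>i\<le>t. m ^ i) < m ^ Suc t"
proof (induction t)
  case 0
  then show ?case
    using assms by simp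
next
  case (Suc t)
  then have "(\<Sum>i\<le>Suc t. m ^ i) < 2 * m ^ Suc t"
    by simp
  also have "\<dots> \<le> m * m ^ Suc t"
    using assms by (rule mult_le_mono1)
  finally show ?case
    by simp
qed

text \<open>In logarithms to base \<open>n\<close>, the code has size \<open>k * k\<close> and
  \<open>n * card H\<close> has size \<open>2 * k + 2\<close>. The monomials are outnumbered once
  \<open>(2 * k + 2) * (2 * T + 1) \<le> k * k\<close>, which \<open>T\<close> ensures because
  \<open>2 * k + 2 \<le> 3 * k\<close>.\<close>

lemma ex_symmetric_function:
  assumes "2 \<le> n" and T: "6 * T + 3 \<le> Suc (n div 2)"
  shows "\<exists>(H :: nat set) f. finite H \<and> dom f \<subseteq> inputs H n \<and> symmetric_pfun n f \<and>
    QC H n f \<le> 1 \<and> enat (Suc T) \<le> Q2 H n f"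
proof -
  define g where "g = n div 2"
  define k where "k = Suc g"
  \<comment> \<open>With this range of coefficients the values stay below
    \<open>n ^ (2 * k)\<close>: the exponent of the alphabet is linear in \<open>k\<close>, that of
    the code quadratic.\<close>
  define B where "B = n ^ k"
  define C where "C = {c. set c \<subseteq> {..<B} \<and> length c = k}"
  define H where "H = prod_encode ` ({..<n} \<times> {..<B * n ^ k})"
  define E where "E = code_word n ` C"
  have "2 \<le> k" "2 * g \<le> n"
    using assms(1) by (auto simp: k_def g_def)
  have "finite H"
    by (simp add: H_def)
  have card_H: "card H = n * n ^ (2 * k)"
    unfolding H_def by (subst card_image) (auto simp: card_cartesian_product B_def inj_prod_encode mult_2 power_add)
  have C: "finite C" "card C = n ^ (k * k)"
    unfolding C_def by (simp_all add: finite_lists_length_eq card_lists_length_eq B_def power_mult)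
  have far: "2 * length (filter (\<lambda>h. h \<in> set (code_word n c)) (code_word n c')) \<le> n"
    if "c \<in> C" "c' \<in> C" "c \<noteq> c'" for c c'
  proof -
    have "length (filter (\<lambda>h. h \<in> set (code_word n c)) (code_word n c')) \<le> g"
      using that by (intro code_word_far) (auto simp: C_def k_def)
    then show ?thesis
      using \<open>2 * g \<le> n\<close> by simp
  qed
  \<comment> \<open>Equal words would share all \<open>n\<close> letters, contrary to
    \<open>far\<close>.\<close>
  have inj: "inj_on (code_word n) C"
  proof (rule inj_onI, rule ccontr)
    fix c c' assume c: "c \<in> C" "c' \<in> C" "c \<noteq> c'" and "code_word n c = code_word n c'"
    then have "2 * length (code_word n c') \<le> n"
      using far[OF c] by simp
    then show False
      using assms(1) by (simp add: code_word_def)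
  qed
  have "E \<subseteq> inputs H n"
  proof
    fix Y assume "Y \<in> E"
    then obtain c where c: "c \<in> C" "Y = code_word n c"
      by (auto simp: E_def)
    have "int_poly c i < B * n ^ k" if "i < n" for i
      using int_poly_less[of c B i n] that assms(1) c(1) by (simp add: C_def B_def)
    then show "Y \<in> inputs H n"
      by (auto simp: c(2) inputs_def code_word_def H_def)
  qed
  moreover have "(\<Sum>i\<le>2 * T. (n * card H) ^ i) < card E"
  proof -
    have m: "n * card H = n ^ (2 * k + 2)"
      by (simp add: card_H power_add power2_eq_square)
    have "2 \<le> n ^ (2 * k + 2)"
      using self_le_power[of n "2 * k + 2"] assms(1) by linarith
    then have "(\<Sum>i\<le>2 * T. (n * card H) ^ i) < (n ^ (2 * k + 2)) ^ Suc (2 * T)"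
      unfolding m by (rule sum_power_less)
    also have "\<dots> = n ^ ((2 * k + 2) * Suc (2 * T))"
      by (simp only: power_mult)
    also have "\<dots> \<le> n ^ (k * k)"
    proof (rule power_increasing)
      have "(2 * k + 2) * Suc (2 * T) \<le> (3 * k) * Suc (2 * T)"
        using \<open>2 \<le> k\<close> by (intro mult_le_mono1) simp
      also have "\<dots> = k * (6 * T + 3)"
        by (simp add: algebra_simps)
      also have "\<dots> \<le> k * k"
        using T by (intro mult_le_mono2) (simp add: k_def g_def)
      finally show "(2 * k + 2) * Suc (2 * T) \<le> k * k" .
    qed (use assms(1) in simp)
    finally show ?thesis
      using C inj by (simp add: E_def card_image)
  qed
  moreover have "2 * length (filter (\<lambda>h. h \<in> set Z) Z') \<le> n" if "Z \<in> E" "Z' \<in> E" "Z \<noteq> Z'" for Z Z'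
    using that far by (auto simp: E_def)
  moreover have "finite E"
    using C by (simp add: E_def)
  ultimately obtain f where "dom f \<subseteq> inputs H n" "symmetric_pfun n f" "QC H n f \<le> 1" "enat (Suc T) \<le> Q2 H n f"
    using ex_function_of_far_code[OF \<open>finite H\<close>, of E n T] assms(1) by blast
  with \<open>finite H\<close> show ?thesis
    by blast
qed

theorem theorem16:
  shows "\<exists>(K::real) (c::real) (n0::nat). K > 0 \<and> c > 0 \<and>
    (\<forall>n\<ge>n0. \<exists>(H :: nat set) (f :: nat list \<rightharpoonup> bool).
       finite H \<and> dom f \<subseteq> inputs H n \<and> symmetric_pfun n f \<and>
       ereal_of_enat (QC H n f) \<le> ereal K \<and>
       ereal_of_enat (Q2 H n f) \<ge> ereal (c * (real n / ln (real n))))"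
proof (rule exI[of _ 1], rule exI[of _ "1/24"], rule exI[of _ 6], intro conjI allI impI)
  fix n :: nat
  assume n: "6 \<le> n"
  \<comment> \<open>The largest \<open>T\<close> with \<open>6 * T + 3 \<le> Suc (n div 2)\<close>;
    \<open>6 \<le> n\<close> keeps the subtraction from truncating.\<close>
  define T where "T = (Suc (n div 2) - 3) div 6"
  have "6 * T + 3 \<le> Suc (n div 2)"
    using n unfolding T_def by linarith
  then obtain H :: "nat set" and f where f: "finite H" "dom f \<subseteq> inputs H n" "symmetric_pfun n f"
      "QC H n f \<le> 1" "enat (Suc T) \<le> Q2 H n f"
    using ex_symmetric_function[of n T] n by auto
  have "Suc (n div 2) - 3 < 6 * Suc T"
    using dividend_less_times_div[of 6 "Suc (n div 2) - 3"] by (simp add: T_def)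
  \<comment> \<open>The inequality above gives \<open>n \<le> 12 * T + 15\<close>, whence the
    constant 24.\<close>
  then have "n \<le> 24 * Suc T"
    using n by linarith
  \<comment> \<open>The bound obtained is linear in \<open>n\<close>; dividing by
    \<open>ln n \<ge> 1\<close> only weakens it to the stated form.\<close>
  have "exp 1 \<le> real n"
    using exp_le n by linarith
  then have "1 \<le> ln (real n)"
    using n by (subst ln_ge_iff) auto
  then have "real n / ln (real n) \<le> real n / 1"
    by (intro divide_left_mono) auto
  also have "\<dots> \<le> 24 * real (Suc T)"
    using \<open>n \<le> 24 * Suc T\<close> by linarith
  finally have "ereal (1/24 * (real n / ln (real n))) \<le> ereal_of_enat (enat (Suc T))"
    by simp
  also have "\<dots> \<le> ereal_of_enat (Q2 H n f)"
    using f(5) by (simp only: ereal_of_enat_le_iff)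
  finally have "ereal (1/24 * (real n / ln (real n))) \<le> ereal_of_enat (Q2 H n f)" .
  moreover have "ereal_of_enat (QC H n f) \<le> ereal_of_enat 1"
    using f(4) by (simp only: ereal_of_enat_le_iff)
  then have "ereal_of_enat (QC H n f) \<le> ereal 1"
    by (simp add: one_enat_def)
  ultimately show "\<exists>(H :: nat set) (f :: nat list \<rightharpoonup> bool).
      finite H \<and> dom f \<subseteq> inputs H n \<and> symmetric_pfun n f \<and> ereal_of_enat (QC H n f) \<le> ereal 1 \<and>
      ereal_of_enat (Q2 H n f) \<ge> ereal (1/24 * (real n / ln (real n)))"
    using f(1-3) by blast
qed simp_all

end
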